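(* There exists a universal constant $A>0$ such that the following holds. Let $n,p,s,k$ be positive integers with $s\le k<p$, let $c\in\mathbb{R}$ with $c^2<1/k$, let $\alpha\in(0,1/2]$, and let $X$ be a real $n\times p$ matrix such that $$X^tX=\begin{bmatrix} I_k & [0] & [c]\\ [0] & I_{p-k-1} & [0]\\ [c] & [0] & 1\end{bmatrix},$$ a $3\times 3$ block matrix with block sizes $(k,p-k-1,1)\times(k,p-k-1,1)$, where $[a]$ means that all entries of the corresponding block are equal to $a$. Then $$K(X,\mathcal{M}_s,\alpha,\infty)\;\ge\;A\,\frac{c(s-1)}{\sqrt{1-(s-1)c^2}}\sqrt{\log\lfloor k/s\rfloor}-\sqrt{2\log 2}.$$
   Context: $X_M$ denotes the submatrix of $X$ formed by the columns with indices in $M\subset\{1,\ldots,p\}$, and $^t$ denotes transpose. $\mathcal{M}_s$ is the set of non-empty $M\subset\{1,\ldots,p\}$ with $|M|\le s$. (Since $kc^2<1$, the displayed Gram matrix is invertible, so every $X_M$ has full column rank; such an $X$ exists if and only if $n\ge p$.) For $M\in\mathcal{M}_s$ and $i\in M$, let $i.M\in\{1,\ldots,|M|\}$ be the rank of $i$ among the elements of $M$ in increasing order, let $e_a^b$ be the $a$-th standard basis column vector of $\mathbb{R}^b$, and set $$v_{M,i}^t=(e_{i.M}^{|M|})^t(X_M^tX_M)^{-1}X_M^t,\qquad w_{M,i}=v_{M,i}/\|v_{M,i}\| \ (\text{and } w_{M,i}=0 \text{ if } v_{M,i}=0).$$ With $\xi$ a standard Gaussian vector in $\mathbb{R}^n$,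 the PoSI constant $K(X,\mathcal{M}_s,\alpha,\infty)$ is the $(1-\alpha)$-quantile of the random variable $\max_{M\in\mathcal{M}_s,\,i\in M}|w_{M,i}^t\xi|$. *)

theory Defs
  imports
    "HOL-Probability.Probability"
    "Jordan_Normal_Form.DL_Submatrix"
    "Jordan_Normal_Form.Gauss_Jordan_Elimination"
begin

unbundle no inner_syntax

text \<open>
  Columns, rows and coordinates are numbered from 0, so a model is a subset of
  \<open>{0..<p}\<close>, and the rank of \<open>i\<close> in \<open>M\<close> is \<open>card {j \<in> M. j < i}\<close>.
\<close>

definition models :: "nat \<Rightarrow> nat \<Rightarrow> nat set set" where
  "models p s = {M. M \<subseteq> {0..<p} \<and> M \<noteq> {} \<and> card M \<le> s}"

definition euclid_norm :: "real vec \<Rightarrow> real" where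
  "euclid_norm v = sqrt (v \<bullet> v)"

definition cols_submatrix :: "real mat \<Rightarrow> nat set \<Rightarrow> real mat" where
  "cols_submatrix X M = submatrix X UNIV M"

definition rank_in :: "nat \<Rightarrow> nat set \<Rightarrow> nat" where
  "rank_in i M = card {j \<in> M. j < i}"

text \<open>\<^const>\<open>mat_inverse\<close> returns an option; the value below is meaningful when the Gram
  matrix of the selected columns is invertible.\<close>

definition posi_v :: "real mat \<Rightarrow> nat set \<Rightarrow> nat \<Rightarrow> real vec" where
  "posi_v X M i =
    (let XM = cols_submatrix X M
     in transpose_mat (the (mat_inverse (transpose_mat XM * XM)) * transpose_mat XM)
          *\<^sub>v unit_vec (card M) (rank_in i M))"

definition posi_w :: "real mat \<Rightarrow> nat set \<Rightarrow> nat \<Rightarrow> real vec" where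
  "posi_w X M i =
    (let v = posi_v X M i
     in if v = 0\<^sub>v (dim_row X) then 0\<^sub>v (dim_row X) else (1 / euclid_norm v) \<cdot>\<^sub>v v)"

text \<open>The law of a standard Gaussian vector with coordinates \<open>\<xi> 0, \<dots>, \<xi> (n - 1)\<close>;
  an outcome \<open>\<xi>\<close> is turned into a vector by \<^term>\<open>Matrix.vec n \<xi>\<close>.\<close>

definition std_gaussian :: "nat \<Rightarrow> (nat \<Rightarrow> real) measure" where
  "std_gaussian n = (\<Pi>\<^sub>M j\<in>{..<n}. density lborel std_normal_density)"

definition quantile :: "'a measure \<Rightarrow> ('a \<Rightarrow> real) \<Rightarrow> real \<Rightarrow> real" where
  "quantile P f q = Inf {t. q \<le> measure P {\<omega> \<in> space P. f \<omega> \<le> t}}"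

definition posi_max :: "real mat \<Rightarrow> nat set set \<Rightarrow> (nat \<Rightarrow> real) \<Rightarrow> real" where
  "posi_max X \<M> \<xi> = Max {\<bar>posi_w X M i \<bullet> Matrix.vec (dim_row X) \<xi>\<bar> | M i. M \<in> \<M> \<and> i \<in> M}"

text \<open>The PoSI constant \<open>K(X, \<M>, \<alpha>, \<infinity>)\<close>.\<close>

definition posi_K :: "real mat \<Rightarrow> nat set set \<Rightarrow> real \<Rightarrow> real" where
  "posi_K X \<M> \<alpha> = quantile (std_gaussian (dim_row X)) (posi_max X \<M>) (1 - \<alpha>)"

definition const_mat :: "nat \<Rightarrow> nat \<Rightarrow> real \<Rightarrow> real mat" where
  "const_mat nr nc a = Matrix.mat nr nc (\<lambda>_. a)"

text \<open>The symmetric matrix with block rows \<open>(I, 0, [c])\<close>, \<open>(0, I, 0)\<close>, \<open>([c], 0, 1)\<close> and block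
  sizes \<open>k, q, 1\<close>; the first two block rows and columns are grouped together.\<close>

definition target_gram :: "nat \<Rightarrow> nat \<Rightarrow> real \<Rightarrow> real mat" where
  "target_gram k q c =
    four_block_mat
      (four_block_mat (1\<^sub>m k) (0\<^sub>m k q) (0\<^sub>m q k) (1\<^sub>m q))
      (const_mat k 1 c @\<^sub>r 0\<^sub>m q 1)
      (transpose_mat (const_mat k 1 c @\<^sub>r 0\<^sub>m q 1))
      (1\<^sub>m 1)"

end

(*
  Take M = D Un {p} with D a subset of {1..k} of size s - 1. The projection defining w_{M,p} gives
  w_{M,p} . xi = (Z_p - c * sum_{j in D} Z_j) / sqrt (1 - (s - 1) c^2), where Z_j = x_j . xi are
  standard Gaussian and Z_1, ..., Z_k are pairwise independent. Since D is free and the maximum is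
  over absolute values, it suffices that with high probability some D has a sum of order
  s * sqrt (log floor(k/s)), and some other D a sum of the opposite sign and the same order. This
  follows from Chebyshev's inequality for the number of j with Z_j >= sqrt (log floor(k/s)) as soon as
  s exceeds an absolute constant; for smaller s the term sqrt (2 log 2) makes the bound trivial.
  No Gaussian concentration inequality is needed.
*)
theory Submission
  imports Defs "Jordan_Normal_Form.Determinant"
begin

unbundle no inner_syntax

text \<open>The variance of a count involves only pairs of events, so pairwise independence of the
  functionals is all that is needed. It is read off from a factored joint characteristic function.
  Why the threshold is sqrt (ln m) with m = floor (k/s): at this height a standard Gaussian has tail
  at least \<open>tail_const\<close> / m, and of the order of s * m indices are searched, so the
  expected number of exceedances is at least a fixed multiple of s. Aiming at sqrt (2 * ln m) would
  improve constants only, and would require a sharp tail estimate. The obstacle is that this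
  multiple of s is smaller than s - 1. The missing indices must not depend on the outcome, for
  otherwise their sum has no usable second moment. They are therefore reserved before the search.
  Their sum is of order sqrt s and is dominated by the exceedances only for large s, which is why
  small s is treated separately.\<close>

section \<open>Independence from joint characteristic functions\<close>

text \<open>Under the probability measure with density g / c the variable X has characteristic
  function \<open>char N\<close>, so the one-dimensional uniqueness theorem identifies its law. The
  weight g carries the information about a second variable.\<close>

lemma (in prob_space) weighted_Levy_uniqueness:
  fixes X g :: "'a \<Rightarrow> real"
  assumes X [measurable]: "X \<in> borel_measurable M" and g [measurable]: "g \<in> borel_measurable M"
    and g0: "\<And>x. 0 \<le> g x" and gB: "\<And>x. g x \<le> B"
    and N: "real_distribution N"
    and ch: "\<And>u. (CLINT x|M. complex_of_real (g x) * iexp (u * X x)) = complex_of_real c * char N u"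
    and A [measurable]: "A \<in> sets borel"
  shows "(LINT x|M. g x * indicator A (X x)) = c * measure N A"
proof -
  interpret N: real_distribution N by (rule N)
  have int_g: "integrable M g"
    by (rule integrable_const_bound[where B = B]) (auto simp: g0 gB)
  \<comment> \<open>The hypothesis at u = 0 says that c is the total mass of g. If it is 0,
    normalising is impossible, but then g vanishes almost everywhere.\<close>
  have c: "(LINT x|M. g x) = c"
    using ch[of 0] by (simp add: N.char_zero del: of_real_mult)
  then have c0: "0 \<le> c" using g0 by (metis Bochner_Integration.integral_nonneg)
  show ?thesis
  proof (cases "c = 0")
    case True
    then have "AE x in M. g x = 0"
      using integral_nonneg_eq_0_iff_AE[OF int_g] g0 c by auto
    then have "(LINT x|M. g x * indicator A (X x)) = (LINT x|M. 0)"
      by (intro integral_cong_AE) auto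
    then show ?thesis using True by simp
  next
    case False
    with c0 have cp: "0 < c" by simp
    define D where "D = density M (\<lambda>x. ennreal (g x / c))"
    have [measurable_cong]: "sets D = sets M" by (simp add: D_def)
    have "emeasure D (space D) = (\<integral>\<^sup>+x. ennreal (g x / c) \<partial>M)"
      unfolding D_def by (subst emeasure_density) (auto intro!: nn_integral_cong)
    also have "\<dots> = ennreal (LINT x|M. g x / c)"
      using int_g g0 cp by (intro nn_integral_eq_integral) auto
    also have "\<dots> = 1" using c cp by simp
    finally interpret D: prob_space D by (rule prob_spaceI)
    have XD [measurable]: "X \<in> borel_measurable D" by (simp add: measurable_def D_def X[unfolded measurable_def])
    have rd: "real_distribution (distr D borel X)"
      by (rule D.real_distribution_distr) simp
    have "char (distr D borel X) = char N"
    proof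
      fix u
      have "char (distr D borel X) u = (CLINT x|D. iexp (u * X x))"
        unfolding char_def by (subst integral_distr) auto
      also have "\<dots> = (CLINT x|M. (g x / c) *\<^sub>R iexp (u * X x))"
        unfolding D_def by (subst integral_density) (auto simp: g0 cp less_imp_le)
      also have "\<dots> = (CLINT x|M. (complex_of_real (g x) * iexp (u * X x)) / complex_of_real c)"
        by (simp add: scaleR_conv_of_real)
      also have "\<dots> = char N u"
        using ch[of u] cp by (simp add: mult.commute)
      finally show "char (distr D borel X) u = char N u" .
    qed
    then have "distr D borel X = N" by (rule Levy_uniqueness[OF rd N])
    then have "measure N A = measure (distr D borel X) A" by simp
    also have "\<dots> = (LINT x|distr D borel X. indicator A x)" by simp
    also have "\<dots> = (LINT x|D. indicator A (X x))"
      by (subst integral_distr) auto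
    also have "\<dots> = (LINT x|M. (g x / c) *\<^sub>R indicator A (X x))"
      unfolding D_def by (subst integral_density) (auto simp: g0 cp less_imp_le)
    also have "\<dots> = (LINT x|M. (g x * indicator A (X x)) / c)" by simp
    also have "\<dots> = (LINT x|M. g x * indicator A (X x)) / c" by (rule integral_divide_zero)
    finally show ?thesis using cp by simp
  qed
qed

text \<open>Weighting the law of \<open>X\<close> by the positive functions \<open>1 + cos (t * Y)\<close> and \<open>1 + sin (t * Y)\<close>
  reduces the two-dimensional uniqueness statement to Levy's theorem on the line.\<close>

lemma (in prob_space) indep_of_joint_char:
  fixes X Y :: "'a \<Rightarrow> real"
  assumes X [measurable]: "X \<in> borel_measurable M" and Y [measurable]: "Y \<in> borel_measurable M"
    and N1: "real_distribution N1" and N2: "real_distribution N2"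
    and ch: "\<And>s t. (CLINT x|M. iexp (s * X x + t * Y x)) = char N1 s * char N2 t"
    and A [measurable]: "A \<in> sets borel" and B [measurable]: "B \<in> sets borel"
  shows "prob {x \<in> space M. X x \<in> A \<and> Y x \<in> B} = measure N1 A * measure N2 B"
proof -
  interpret N1: real_distribution N1 by (rule N1)
  interpret N2: real_distribution N2 by (rule N2)
  define J where "J s t x = iexp (s * X x + t * Y x)" for s t x
  have int [simp]: "integrable M (J s t)" for s t
    unfolding J_def by (rule integrable_const_bound[where B = 1]) auto
  have chJ: "(CLINT x|M. J s t x) = char N1 s * char N2 t" for s t
    unfolding J_def by (rule ch)
  have cisum: "J s t x = iexp (s * X x) * (complex_of_real (cos (t * Y x)) + \<i> * complex_of_real (sin (t * Y x)))" for s t x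
    by (simp add: J_def exp_add ring_distribs exp_Euler cos_of_real sin_of_real flip: of_real_mult)
  \<comment> \<open>The weighted exponentials are combinations of joint exponentials at (s, 0), (s,
    t) and (s, -t), so their integrals are known.\<close>
  have cosx: "complex_of_real (1 + cos (t * Y x)) * iexp (s * X x) =
      J s 0 x + (J s t x + J s (- t) x) / 2" for s t x
    unfolding cisum by (simp add: field_simps)
  have sinx: "complex_of_real (1 + sin (t * Y x)) * iexp (s * X x) =
      J s 0 x + (J s t x - J s (- t) x) / (2 * \<i>)" for s t x
    unfolding cisum by (simp add: field_simps)
  \<comment> \<open>Conjugate symmetry turns the combinations of the values at t and -t into
    \<open>Re\<close> and \<open>Im\<close>, so the factor in front of \<open>char N1 s\<close> is
    real, as the weighted lemma demands.\<close>
  have cnj: "char N2 (- t) = cnj (char N2 t)" for t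
  proof -
    have "cnj (char N2 t) = (CLINT x|N2. cnj (iexp (t * x)))"
      unfolding char_def by (rule Bochner_Integration.integral_cnj[symmetric])
    then show ?thesis unfolding char_def by (simp add: exp_cnj)
  qed
  have cosc: "(CLINT x|M. complex_of_real (1 + cos (t * Y x)) * iexp (s * X x)) =
      complex_of_real (1 + Re (char N2 t)) * char N1 s" for s t
  proof -
    have "(CLINT x|M. complex_of_real (1 + cos (t * Y x)) * iexp (s * X x)) =
      char N1 s * char N2 0 + (char N1 s * char N2 t + char N1 s * char N2 (- t)) / 2"
      unfolding cosx by (simp add: chJ)
    also have "\<dots> = complex_of_real (1 + Re (char N2 t)) * char N1 s"
      unfolding cnj N2.char_zero distrib_left[symmetric] complex_add_cnj
      by (simp add: algebra_simps)
    finally show ?thesis .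
  qed
  have sinc: "(CLINT x|M. complex_of_real (1 + sin (t * Y x)) * iexp (s * X x)) =
      complex_of_real (1 + Im (char N2 t)) * char N1 s" for s t
  proof -
    have "(CLINT x|M. complex_of_real (1 + sin (t * Y x)) * iexp (s * X x)) =
      char N1 s * char N2 0 + (char N1 s * char N2 t - char N1 s * char N2 (- t)) / (2 * \<i>)"
      unfolding sinx by (simp add: chJ)
    also have "\<dots> = complex_of_real (1 + Im (char N2 t)) * char N1 s"
      unfolding cnj N2.char_zero right_diff_distrib[symmetric] complex_diff_cnj
      by (simp add: algebra_simps)
    finally show ?thesis .
  qed
  have law1: "(LINT x|M. indicator A (X x)) = measure N1 A"
    using weighted_Levy_uniqueness[OF X _ _ _ N1, where g = "\<lambda>_. 1" and B = 1 and c = 1 and A = A]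
      ch[of _ 0] by (simp add: N2.char_zero)
  have cosA: "(LINT x|M. cos (t * Y x) * indicator A (X x)) = Re (char N2 t) * measure N1 A" for t
  proof -
    have "(LINT x|M. (1 + cos (t * Y x)) * indicator A (X x)) = (1 + Re (char N2 t)) * measure N1 A"
      by (rule weighted_Levy_uniqueness[OF X _ _ _ N1 cosc A, where B = 2])
        (auto simp: cos_ge_minus_one add.commute intro: add_increasing2 simp flip: diff_le_eq)
    moreover have "(LINT x|M. (1 + cos (t * Y x)) * indicator A (X x)) =
        (LINT x|M. indicator A (X x)) + (LINT x|M. cos (t * Y x) * indicator A (X x))"
      unfolding distrib_right mult_1_left
      by (rule Bochner_Integration.integral_add; rule integrable_const_bound[where B = 1])
        (auto simp: indicator_def)
    ultimately show ?thesis using law1 by (simp add: algebra_simps)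
  qed
  have sinA: "(LINT x|M. sin (t * Y x) * indicator A (X x)) = Im (char N2 t) * measure N1 A" for t
  proof -
    have "(LINT x|M. (1 + sin (t * Y x)) * indicator A (X x)) = (1 + Im (char N2 t)) * measure N1 A"
      by (rule weighted_Levy_uniqueness[OF X _ _ _ N1 sinc A, where B = 2])
        (auto simp: sin_ge_minus_one add.commute simp flip: diff_le_eq)
    moreover have "(LINT x|M. (1 + sin (t * Y x)) * indicator A (X x)) =
        (LINT x|M. indicator A (X x)) + (LINT x|M. sin (t * Y x) * indicator A (X x))"
      unfolding distrib_right mult_1_left
      by (rule Bochner_Integration.integral_add; rule integrable_const_bound[where B = 1])
        (auto simp: indicator_def)
    ultimately show ?thesis using law1 by (simp add: algebra_simps)
  qed
  \<comment> \<open>Second application with the roles exchanged: the weight is now the indicator of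
    the event X in A, and \<open>cosA\<close> and \<open>sinA\<close> supply the transform of Y
    under it.\<close>
  have "(LINT x|M. indicator A (X x) * indicator B (Y x)) = measure N1 A * measure N2 B"
  proof (rule weighted_Levy_uniqueness[OF Y _ _ _ N2 _ B])
    fix t
    have iA: "integrable M (\<lambda>x. complex_of_real (cos (t * Y x) * indicator A (X x)))"
         "integrable M (\<lambda>x. complex_of_real (sin (t * Y x) * indicator A (X x)))"
      by (auto intro!: integrable_of_real integrable_const_bound[where B = 1] simp: indicator_def)
    have "(CLINT x|M. complex_of_real (indicator A (X x)) * iexp (t * Y x)) =
      (CLINT x|M. complex_of_real (cos (t * Y x) * indicator A (X x)) +
         \<i> * complex_of_real (sin (t * Y x) * indicator A (X x)))"
      by (intro Bochner_Integration.integral_cong refl)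
        (simp add: exp_Euler cos_of_real sin_of_real algebra_simps flip: of_real_mult)
    also have "\<dots> = complex_of_real (Re (char N2 t) * measure N1 A)
       + \<i> * complex_of_real (Im (char N2 t) * measure N1 A)"
      using iA cosA[of t] sinA[of t]
      by (simp del: of_real_mult)
    also have "\<dots> = complex_of_real (measure N1 A) * char N2 t"
      by (simp add: complex_eq_iff)
    finally show "(CLINT x|M. complex_of_real (indicator A (X x)) * iexp (t * Y x)) =
      complex_of_real (measure N1 A) * char N2 t" .
  qed (auto simp: indicator_def intro: order_refl[of "1::real"])
  moreover have "(LINT x|M. indicator A (X x) * indicator B (Y x)) =
      (LINT x|M. indicator {x \<in> space M. X x \<in> A \<and> Y x \<in> B} x :: real)"
    by (intro Bochner_Integration.integral_cong refl) (auto simp: indicator_def)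
  ultimately show ?thesis by simp
qed

section \<open>Linear functionals of a standard Gaussian vector\<close>

lemma prob_space_std_gaussian: "prob_space (std_gaussian n)"
  unfolding std_gaussian_def by (rule prob_space_PiM) (rule prob_space_normal_density, simp)

lemma measurable_linear_std_gaussian [measurable]:
  "(\<lambda>\<xi>. \<Sum>i<n. u i * \<xi> i) \<in> borel_measurable (std_gaussian n)"
proof -
  have "(\<lambda>\<xi>. \<xi> i) \<in> borel_measurable (std_gaussian n)" if "i < n" for i
    using measurable_component_singleton[of i "{..<n}" "\<lambda>_. std_normal_distribution"] that
    unfolding std_gaussian_def by simp
  then show ?thesis by (intro borel_measurable_sum borel_measurable_times) auto
qed

text \<open>The product structure of the measure makes the integral factor over coordinates. The
  result depends on u only through its squared norm, so orthogonality of coefficient vectors turns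
  into independence.\<close>

lemma char_linear_std_gaussian:
  "(CLINT \<xi>|std_gaussian n. iexp (\<Sum>i<n. u i * \<xi> i)) = complex_of_real (exp (- (\<Sum>i<n. (u i)\<^sup>2) / 2))"
proof -
  interpret N: real_distribution std_normal_distribution by (rule real_dist_normal_dist)
  interpret P: product_sigma_finite "\<lambda>_::nat. std_normal_distribution" by unfold_locales
  have "(CLINT \<xi>|std_gaussian n. iexp (\<Sum>i<n. u i * \<xi> i)) =
     (CLINT \<xi>|std_gaussian n. \<Prod>i<n. iexp (u i * \<xi> i))"
    by (simp add: exp_sum sum_distrib_left)
  also have "\<dots> = (\<Prod>i<n. char std_normal_distribution (u i))"
    unfolding std_gaussian_def char_def
    by (rule P.product_integral_prod) (auto intro!: N.integrable_const_bound[where B = 1])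
  also have "\<dots> = complex_of_real (exp (\<Sum>i<n. - (u i)\<^sup>2 / 2))"
    by (simp add: char_std_normal_distribution exp_sum flip: exp_of_real)
  also have "(\<Sum>i<n. - (u i)\<^sup>2 / 2) = - (\<Sum>i<n. (u i)\<^sup>2) / 2"
    by (simp add: sum_negf sum_divide_distrib)
  finally show ?thesis .
qed

lemma distr_linear_std_gaussian:
  assumes "(\<Sum>i<n. (u i)\<^sup>2) = 1"
  shows "distr (std_gaussian n) borel (\<lambda>\<xi>. \<Sum>i<n. u i * \<xi> i) = std_normal_distribution"
proof (rule Levy_uniqueness)
  interpret prob_space "std_gaussian n" by (rule prob_space_std_gaussian)
  show "real_distribution (distr (std_gaussian n) borel (\<lambda>\<xi>. \<Sum>i<n. u i * \<xi> i))"
    by (rule real_distribution_distr) simp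
  show "char (distr (std_gaussian n) borel (\<lambda>\<xi>. \<Sum>i<n. u i * \<xi> i)) = char std_normal_distribution"
  proof
    fix t
    have "(CLINT \<xi>|std_gaussian n. iexp (t * (\<Sum>i<n. u i * \<xi> i))) =
      (CLINT \<xi>|std_gaussian n. iexp (\<Sum>i<n. (t * u i) * \<xi> i))"
      by (simp add: sum_distrib_left mult.assoc)
    also have "\<dots> = complex_of_real (exp (- t\<^sup>2 / 2))"
      unfolding char_linear_std_gaussian using assms by (simp add: power_mult_distrib flip: sum_distrib_left)
    finally show "char (distr (std_gaussian n) borel (\<lambda>\<xi>. \<Sum>i<n. u i * \<xi> i)) t = char std_normal_distribution t"
      unfolding char_std_normal_distribution char_def by (subst integral_distr) auto
  qed
qed (rule real_dist_normal_dist)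

lemma orthonormal_linear_std_gaussian:
  assumes u: "(\<Sum>i<n. (u i)\<^sup>2) = 1" and v: "(\<Sum>i<n. (v i)\<^sup>2) = 1" and uv: "(\<Sum>i<n. u i * v i) = 0"
    and AB: "A \<in> sets borel" "B \<in> sets borel"
  shows "measure (std_gaussian n) {\<xi> \<in> space (std_gaussian n).
      (\<Sum>i<n. u i * \<xi> i) \<in> A \<and> (\<Sum>i<n. v i * \<xi> i) \<in> B} =
    measure std_normal_distribution A * measure std_normal_distribution B"
proof -
  interpret prob_space "std_gaussian n" by (rule prob_space_std_gaussian)
  show ?thesis
  proof (rule indep_of_joint_char[OF _ _ real_dist_normal_dist real_dist_normal_dist _ AB])
    fix s t
    \<comment> \<open>The cross term vanishes by orthogonality, so the exponent splits and the joint
      characteristic function factors.\<close>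
    have "(\<Sum>i<n. (s * u i + t * v i)\<^sup>2) =
      s\<^sup>2 * (\<Sum>i<n. (u i)\<^sup>2) + t\<^sup>2 * (\<Sum>i<n. (v i)\<^sup>2) + 2 * s * t * (\<Sum>i<n. u i * v i)"
      by (simp add: sum_distrib_left sum.distrib[symmetric] power2_eq_square algebra_simps)
    then have sq: "(\<Sum>i<n. (s * u i + t * v i)\<^sup>2) = s\<^sup>2 + t\<^sup>2" using u v uv by simp
    have "(CLINT \<xi>|std_gaussian n. iexp (s * (\<Sum>i<n. u i * \<xi> i) + t * (\<Sum>i<n. v i * \<xi> i))) =
      (CLINT \<xi>|std_gaussian n. iexp (\<Sum>i<n. (s * u i + t * v i) * \<xi> i))"
      by (simp add: sum_distrib_left distrib_right mult.assoc sum.distrib)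
    also have "\<dots> = complex_of_real (exp (- s\<^sup>2 / 2 + - t\<^sup>2 / 2))"
      unfolding char_linear_std_gaussian sq by (simp add: add_divide_distrib)
    finally show "(CLINT \<xi>|std_gaussian n. iexp (s * (\<Sum>i<n. u i * \<xi> i) + t * (\<Sum>i<n. v i * \<xi> i))) =
       char std_normal_distribution s * char std_normal_distribution t"
      unfolding char_std_normal_distribution exp_add of_real_mult .
  qed auto
qed

section \<open>Large subset sums of orthonormal functionals\<close>

text \<open>Pairwise independence kills the covariances, so the variance of the count is at most its
  mean. Chebyshev's inequality for a deviation of half the mean then gives 4 / mean.\<close>

lemma (in prob_space) pairwise_indep_few_events:
  fixes E :: "'i \<Rightarrow> 'a set"
  assumes R: "finite R" and E [measurable]: "\<And>j. j \<in> R \<Longrightarrow> E j \<in> events"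
    and q: "\<And>j. j \<in> R \<Longrightarrow> prob (E j) = q"
    and qq: "\<And>i j. i \<in> R \<Longrightarrow> j \<in> R \<Longrightarrow> i \<noteq> j \<Longrightarrow> prob (E i \<inter> E j) = q\<^sup>2"
    and pos: "0 < q * card R"
  shows "prob {x \<in> space M. real (card {j \<in> R. x \<in> E j}) \<le> q * card R / 2} \<le> 4 / (q * card R)"
proof -
  define N where "N x = (\<Sum>j\<in>R. indicator (E j) x :: real)" for x
  have N_card: "N x = real (card {j \<in> R. x \<in> E j})" for x
    using R unfolding N_def by (simp add: indicator_def sum.If_cases Int_def)
  have N_meas [measurable]: "N \<in> borel_measurable M"
    unfolding N_def by (intro borel_measurable_sum borel_measurable_indicator E)
  have int1: "integrable M (indicator (E j) :: 'a \<Rightarrow> real)" if "j \<in> R" for j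
    using E[OF that] by (simp add: emeasure_eq_measure)
  have EN: "expectation N = q * card R"
    unfolding N_def using E q int1 by (subst Bochner_Integration.integral_sum) auto
  have int2: "integrable M (\<lambda>x. indicator (E i) x * indicator (E j) x :: real)" if "i \<in> R" "j \<in> R" for i j
    using E[OF that(1)] E[OF that(2)] by (simp add: emeasure_eq_measure flip: indicator_inter_arith)
  have N2: "N x ^ 2 = (\<Sum>i\<in>R. \<Sum>j\<in>R. indicator (E i) x * indicator (E j) x)" for x
    unfolding N_def power2_eq_square by (rule sum_product)
  have intN2: "integrable M (\<lambda>x. N x ^ 2)" unfolding N2 by (intro Bochner_Integration.integrable_sum int2)
  have intN: "integrable M N" unfolding N_def by (intro Bochner_Integration.integrable_sum int1)
  have "expectation (\<lambda>x. N x ^ 2) = (\<Sum>i\<in>R. \<Sum>j\<in>R. prob (E i \<inter> E j))"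
    unfolding N2 using int2 E
    by (simp add: Bochner_Integration.integral_sum flip: indicator_inter_arith)
  \<comment> \<open>Off the diagonal the terms equal q^2. On it they equal q, and adding q^2 there
    lets the double sum split into the squared mean plus the mean.\<close>
  also have "\<dots> \<le> (\<Sum>i\<in>R. \<Sum>j\<in>R. q\<^sup>2 + (if i = j then q else 0))"
    using q qq by (intro sum_mono) auto
  also have "\<dots> = q\<^sup>2 * (card R)\<^sup>2 + q * card R"
    using R by (simp add: sum.distrib power2_eq_square algebra_simps)
  finally have "variance N \<le> q * card R"
    unfolding variance_eq[OF intN intN2] by (simp add: EN power_mult_distrib)
  then have "variance N / (q * card R / 2)\<^sup>2 \<le> q * card R / (q * card R / 2)\<^sup>2"
    by (intro divide_right_mono) auto
  also have "\<dots> = 4 / (q * card R)" using pos by (simp add: power2_eq_square)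
  finally have var: "variance N / (q * card R / 2)\<^sup>2 \<le> 4 / (q * card R)" .
  have "prob {x \<in> space M. real (card {j \<in> R. x \<in> E j}) \<le> q * card R / 2}
      \<le> prob {x \<in> space M. \<bar>N x - expectation N\<bar> \<ge> q * card R / 2}"
    unfolding EN by (intro finite_measure_mono) (use pos in \<open>auto simp: abs_if simp flip: N_card\<close>)
  also have "\<dots> \<le> variance N / (q * card R / 2)\<^sup>2"
    using pos intN2 by (intro Chebyshev_inequality) auto
  finally show ?thesis using var by linarith
qed

text \<open>The factor that remains when the standard normal density on a unit interval starting at
  \<tau> is compared with exp (- \<tau>^2).\<close>

definition tail_const :: real where
  "tail_const = exp (-1) / sqrt (2 * pi)"

lemma tail_const_pos: "0 < tail_const"
  by (simp add: tail_const_def)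

lemma tail_const_le_1: "tail_const \<le> 1"
proof -
  have "1 \<le> sqrt (2 * pi)" using pi_gt3 by simp
  moreover have "exp (-1) \<le> (1::real)" by simp
  ultimately show ?thesis unfolding tail_const_def by (intro divide_le_eq_1_pos[THEN iffD2]) linarith+
qed

text \<open>The density is bounded below by its value at \<open>\<tau> + 1\<close> on \<open>[\<tau>, \<tau> + 1]\<close>, and \<open>(\<tau> + 1)\<^sup>2 / 2 \<le> \<tau>\<^sup>2 + 1\<close>.\<close>

lemma std_normal_tail_ge:
  assumes "0 \<le> \<tau>"
  shows "tail_const * exp (- \<tau>\<^sup>2) \<le> measure std_normal_distribution {\<tau>..}"
proof -
  interpret real_distribution std_normal_distribution by (rule real_dist_normal_dist)
  have dens: "tail_const * exp (- \<tau>\<^sup>2) \<le> std_normal_density x" if x: "x \<in> {\<tau>..\<tau> + 1}" for x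
  proof -
    have "x\<^sup>2 \<le> (\<tau> + 1)\<^sup>2" using x assms by (intro power_mono) auto
    moreover have "0 \<le> (\<tau> - 1)\<^sup>2" by simp
    ultimately have "- 1 - \<tau>\<^sup>2 \<le> - x\<^sup>2 / 2" by (simp add: power2_eq_square algebra_simps)
    then have "exp (- 1 - \<tau>\<^sup>2) \<le> exp (- x\<^sup>2 / 2)" by simp
    then have "exp (- 1) * exp (- \<tau>\<^sup>2) \<le> exp (- x\<^sup>2 / 2)"
      by (metis exp_add uminus_add_conv_diff add_uminus_conv_diff)
    then show ?thesis
      unfolding tail_const_def std_normal_density_def by (simp add: divide_right_mono)
  qed
  have "ennreal (tail_const * exp (- \<tau>\<^sup>2)) =
      (\<integral>\<^sup>+x. ennreal (tail_const * exp (- \<tau>\<^sup>2)) * indicator {\<tau>..\<tau> + 1} x \<partial>lborel)"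
    by (subst nn_integral_cmult_indicator) auto
  also have "\<dots> \<le> (\<integral>\<^sup>+x. ennreal (std_normal_density x) * indicator {\<tau>..} x \<partial>lborel)"
    using dens by (intro nn_integral_mono) (auto simp: indicator_def intro!: ennreal_leI)
  also have "\<dots> = emeasure std_normal_distribution {\<tau>..}"
    by (subst emeasure_density) auto
  finally show ?thesis
    unfolding emeasure_eq_measure by (simp add: measure_nonneg)
qed

lemma second_moment_linear_std_gaussian:
  "integrable (std_gaussian n) (\<lambda>\<xi>. (\<Sum>i<n. u i * \<xi> i)\<^sup>2)"
  "(LINT \<xi>|std_gaussian n. (\<Sum>i<n. u i * \<xi> i)\<^sup>2) = (\<Sum>i<n. (u i)\<^sup>2)"
proof -
  define S where "S = (\<Sum>i<n. (u i)\<^sup>2)"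
  have "integrable (std_gaussian n) (\<lambda>\<xi>. (\<Sum>i<n. u i * \<xi> i)\<^sup>2) \<and>
    (LINT \<xi>|std_gaussian n. (\<Sum>i<n. u i * \<xi> i)\<^sup>2) = S"
  proof (cases "S = 0")
    case True
    then have "u i = 0" if "i < n" for i
      using that by (simp add: S_def sum_nonneg_eq_0_iff)
    then have "(\<Sum>i<n. u i * \<xi> i) = 0" for \<xi> by simp
    then show ?thesis using True by simp
  next
    case False
    then have S: "0 < S" by (simp add: S_def sum_nonneg order_less_le)
    define v where "v i = u i / sqrt S" for i
    have v1: "(\<Sum>i<n. (v i)\<^sup>2) = 1"
      using S by (simp add: v_def power_divide S_def flip: sum_divide_distrib)
    have uv: "(\<Sum>i<n. u i * \<xi> i)\<^sup>2 = S * (\<Sum>i<n. v i * \<xi> i)\<^sup>2" for \<xi>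
      using S by (simp add: v_def power_divide flip: sum_divide_distrib)
    have "integrable (distr (std_gaussian n) borel (\<lambda>\<xi>. \<Sum>i<n. v i * \<xi> i)) (\<lambda>x. x\<^sup>2)"
      unfolding distr_linear_std_gaussian[OF v1] by (rule integrable_std_normal_distribution_moment)
    moreover have "(LINT x|distr (std_gaussian n) borel (\<lambda>\<xi>. \<Sum>i<n. v i * \<xi> i). x\<^sup>2) = 1"
      unfolding distr_linear_std_gaussian[OF v1]
      using std_normal_distribution_even_moments(1)[of 1] by (simp add: fact_numeral)
    ultimately show ?thesis
      unfolding uv by (simp add: integrable_distr_eq integral_distr)
  qed
  then show "integrable (std_gaussian n) (\<lambda>\<xi>. (\<Sum>i<n. u i * \<xi> i)\<^sup>2)"
    "(LINT \<xi>|std_gaussian n. (\<Sum>i<n. u i * \<xi> i)\<^sup>2) = (\<Sum>i<n. (u i)\<^sup>2)"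
    by (auto simp: S_def)
qed

text \<open>Most of the lower bound comes from about \<open>tail_const * s / 8\<close> coordinates above
  \<open>sqrt (ln m)\<close>; they are completed to \<open>s - 1\<close> coordinates by a fixed set of indices, whose sum has
  standard deviation at most \<open>sqrt s\<close>.\<close>

lemma orthonormal_large_subset_sum:
  fixes u :: "nat \<Rightarrow> nat \<Rightarrow> real" and n k m s :: nat
  assumes orth: "\<And>i j. i < k \<Longrightarrow> j < k \<Longrightarrow> (\<Sum>a<n. u i a * u j a) = (if i = j then 1 else 0)"
    and m: "2 \<le> m" and smk: "s * m \<le> k" and s: "8192 / tail_const\<^sup>2 \<le> s"
  obtains bad where "bad \<in> sets (std_gaussian n)" "measure (std_gaussian n) bad \<le> 1/8"
    "\<And>\<xi>. \<xi> \<in> space (std_gaussian n) \<Longrightarrow> \<xi> \<notin> bad \<Longrightarrow>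
      \<exists>D \<subseteq> {..<k}. card D = s - 1 \<and>
        tail_const / 16 * s * sqrt (ln m) \<le> (\<Sum>j\<in>D. \<Sum>a<n. u j a * \<xi> a)"
proof -
  interpret prob_space "std_gaussian n" by (rule prob_space_std_gaussian)
  let ?\<kappa> = tail_const
  let ?Z = "\<lambda>j \<xi>. \<Sum>a<n. u j a * \<xi> a"
  define \<tau> where "\<tau> = sqrt (ln m)"
  define q where "q = measure std_normal_distribution {\<tau>..}"
  \<comment> \<open>The first s - 1 indices are kept out of the search, so the filling set
    \<open>F\<close> is fixed in advance and disjoint from whatever is found in
    \<open>R\<close>.\<close>
  define R where "R = {s - 1..<k}"
  \<comment> \<open>The mean count will be at least \<open>tail_const\<close> * s / 2, and half of
    it is guaranteed. Aiming at a quarter of the mean bound leaves room for rounding up.\<close>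
  define l where "l = nat \<lceil>?\<kappa> * s / 8\<rceil>"
  define F where "F = {..<s - 1 - l}"
  define E where "E j = {\<xi> \<in> space (std_gaussian n). ?Z j \<xi> \<in> {\<tau>..}}" for j
  define bad1 where "bad1 = {\<xi> \<in> space (std_gaussian n). real (card {j \<in> R. \<xi> \<in> E j}) \<le> q * card R / 2}"
  \<comment> \<open>The squared sum over \<open>F\<close> has mean at most s, so Markov's inequality
    with 16 * s bounds this event by 1/16. Outside it the sum exceeds -4 * sqrt s.\<close>
  define bad2 where "bad2 = {\<xi> \<in> space (std_gaussian n). 16 * s \<le> (\<Sum>a<n. (\<Sum>j\<in>F. u j a) * \<xi> a)\<^sup>2}"
  note kp = tail_const_pos and k1 = tail_const_le_1
  have ln2: "2/3 \<le> ln (real m)"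
  proof -
    have "ln 2 \<le> ln (real m)" using m by (subst ln_le_cancel_iff) auto
    then show ?thesis using ln2_ge_two_thirds by linarith
  qed
  have \<tau>2: "\<tau>\<^sup>2 = ln m" and \<tau>0: "0 \<le> \<tau>" using ln2 by (auto simp: \<tau>_def)
  have ks2: "8192 \<le> ?\<kappa>\<^sup>2 * s" using s kp by (simp add: field_simps)
  have "?\<kappa>\<^sup>2 \<le> ?\<kappa>" using kp k1 by (simp add: power2_eq_square mult_left_le)
  then have "?\<kappa>\<^sup>2 * s \<le> ?\<kappa> * s" by (simp add: mult_right_mono)
  then have ks: "8192 \<le> ?\<kappa> * s" using ks2 by linarith
  have "?\<kappa> * s \<le> s" using mult_right_mono[OF k1, of "real s"] by simp
  then have s_big: "8192 \<le> real s" using ks by linarith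
  have l_ge: "?\<kappa> * s / 8 \<le> l" unfolding l_def by linarith
  have "real l < ?\<kappa> * s / 8 + 1" using ks unfolding l_def by linarith
  then have l_le: "real l \<le> ?\<kappa> * s / 4" using ks by linarith
  then have ls: "l \<le> s - 1" using \<open>?\<kappa> * s \<le> s\<close> s_big by linarith
  have sk: "s \<le> k"
  proof -
    have "s * 1 \<le> s * m" using m by (intro mult_le_mono2) simp
    then show ?thesis using smk by linarith
  qed
  have "exp (- \<tau>\<^sup>2) = 1 / m" using m by (simp add: \<tau>2 exp_minus inverse_eq_divide)
  then have q_ge: "?\<kappa> / m \<le> q" using std_normal_tail_ge[OF \<tau>0] by (simp add: q_def)
  \<comment> \<open>Reserving s - 1 indices costs at most half of the s * m available, because m is
    at least 2.\<close>
  have "real s * m / 2 \<le> card R"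
  proof -
    have "real s * m + s * (m - 2) = 2 * (real s * (real m - 1))" using m by (simp add: algebra_simps of_nat_diff)
    moreover have "real s * m \<le> k" using smk by (metis of_nat_le_iff of_nat_mult)
    moreover have "real (card R) = real k - real s + 1" using sk s_big by (simp add: R_def of_nat_diff)
    moreover have "0 \<le> real s * (m - 2)" by simp
    ultimately show ?thesis by (simp add: algebra_simps)
  qed
  then have "(?\<kappa> / m) * (real s * m / 2) \<le> q * card R"
    using q_ge kp by (intro mult_mono) (auto simp: q_def)
  then have qR: "?\<kappa> * s / 2 \<le> q * card R" using m by simp
  have qR64: "64 \<le> q * card R" using qR ks by linarith
  have finR: "finite R" by (simp add: R_def)
  have E_ev: "E j \<in> events" for j unfolding E_def by measurable
  have norm1: "(\<Sum>a<n. (u j a)\<^sup>2) = 1" if "j < k" for j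
    using orth[OF that that] by (simp add: power2_eq_square)
  have PE: "prob (E j) = q" if "j \<in> R" for j
  proof -
    have "q = measure (distr (std_gaussian n) borel (?Z j)) {\<tau>..}"
      using that norm1 by (simp add: q_def distr_linear_std_gaussian R_def)
    also have "\<dots> = prob (E j)" unfolding E_def by (subst measure_distr) (auto simp: vimage_def Int_def conj_commute)
    finally show ?thesis by simp
  qed
  have PEE: "prob (E i \<inter> E j) = q\<^sup>2" if "i \<in> R" "j \<in> R" "i \<noteq> j" for i j
  proof -
    have "E i \<inter> E j = {\<xi> \<in> space (std_gaussian n). ?Z i \<xi> \<in> {\<tau>..} \<and> ?Z j \<xi> \<in> {\<tau>..}}"
      by (auto simp: E_def)
    then show ?thesis
      using orthonormal_linear_std_gaussian[where n = n and u = "u i" and v = "u j" and A = "{\<tau>..}" and B = "{\<tau>..}"] that orth[of i j] norm1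
      by (simp add: R_def q_def power2_eq_square)
  qed
  have "prob bad1 \<le> 4 / (q * card R)"
    unfolding bad1_def by (intro pairwise_indep_few_events finR E_ev PE PEE qR64[THEN less_le_trans[rotated]]) simp_all
  also have "\<dots> \<le> 4 / 64"
    using qR64 by (intro divide_left_mono) auto
  finally have bad1: "prob bad1 \<le> 1/16" by simp
  have F_norm: "(\<Sum>a<n. (\<Sum>j\<in>F. u j a)\<^sup>2) \<le> s"
  proof -
    have "(\<Sum>a<n. (\<Sum>j\<in>F. u j a)\<^sup>2) = (\<Sum>a<n. \<Sum>i\<in>F. \<Sum>j\<in>F. u i a * u j a)"
      by (simp add: power2_eq_square sum_product)
    also have "\<dots> = (\<Sum>i\<in>F. \<Sum>j\<in>F. \<Sum>a<n. u i a * u j a)"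
      by (subst sum.swap) (intro sum.cong refl sum.swap)
    also have "\<dots> = (\<Sum>i\<in>F. \<Sum>j\<in>F. if i = j then 1 else 0)"
      using sk by (intro sum.cong refl orth) (auto simp: F_def)
    also have "\<dots> = card F" by (simp add: F_def)
    also have "\<dots> \<le> s" by (simp add: F_def)
    finally show ?thesis .
  qed
  have "prob bad2 \<le> (\<Sum>a<n. (\<Sum>j\<in>F. u j a)\<^sup>2) / (16 * s)"
    unfolding bad2_def using s_big
      integral_Markov_inequality_measure[OF second_moment_linear_std_gaussian(1)[of n "\<lambda>a. \<Sum>j\<in>F. u j a"],
       of "space (std_gaussian n)" "16 * s"]
    by (simp add: second_moment_linear_std_gaussian)
  also have "\<dots> \<le> 1/16" using F_norm s_big by (simp add: field_simps)
  finally have bad2: "prob bad2 \<le> 1/16" .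
  have ev1: "bad1 \<in> events"
  proof -
    have "(\<lambda>\<xi>. real (card {j \<in> R. \<xi> \<in> E j})) = (\<lambda>\<xi>. \<Sum>j\<in>R. indicator (E j) \<xi>)"
      by (auto simp: indicator_def sum.If_cases Int_def R_def)
    then have [measurable]: "(\<lambda>\<xi>. real (card {j \<in> R. \<xi> \<in> E j})) \<in> borel_measurable (std_gaussian n)"
      using E_ev by simp
    show ?thesis unfolding bad1_def by measurable
  qed
  have ev2: "bad2 \<in> events" unfolding bad2_def by measurable
  show ?thesis
  proof
    show "bad1 \<union> bad2 \<in> events" using ev1 ev2 by simp
    show "prob (bad1 \<union> bad2) \<le> 1/8"
      using measure_Un_le[OF ev1 ev2] bad1 bad2 by linarith
    fix \<xi> assume \<xi>: "\<xi> \<in> space (std_gaussian n)" "\<xi> \<notin> bad1 \<union> bad2"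
    have "real l \<le> q * card R / 2" using l_le qR by linarith
    then have "l \<le> card {j \<in> R. \<xi> \<in> E j}" using \<xi> by (simp add: bad1_def)
    then obtain T where T: "T \<subseteq> {j \<in> R. \<xi> \<in> E j}" "card T = l"
      using obtain_subset_with_card_n[of l "{j \<in> R. \<xi> \<in> E j}"] by metis
    have finT: "finite T" using T(1) by (rule finite_subset) (simp add: R_def)
    have disj: "F \<inter> T = {}" using T by (auto simp: F_def R_def)
    have "(\<Sum>a<n. (\<Sum>j\<in>F. u j a) * \<xi> a) = (\<Sum>j\<in>F. ?Z j \<xi>)"
      unfolding sum_distrib_right by (rule sum.swap)
    then have "(\<Sum>j\<in>F. ?Z j \<xi>)\<^sup>2 < (4 * sqrt s)\<^sup>2"
      using \<xi> by (simp add: bad2_def power_mult_distrib)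
    then have "\<bar>\<Sum>j\<in>F. ?Z j \<xi>\<bar>\<^sup>2 < (4 * sqrt s)\<^sup>2" by (simp only: power2_abs)
    then have "\<bar>\<Sum>j\<in>F. ?Z j \<xi>\<bar> < 4 * sqrt s" by (rule power2_less_imp_less) simp
    then have sumF: "- (4 * sqrt s) \<le> (\<Sum>j\<in>F. ?Z j \<xi>)" by linarith
    have "\<tau> \<le> ?Z j \<xi>" if "j \<in> T" for j using T(1) that by (auto simp: E_def)
    then have sumT: "l * \<tau> \<le> (\<Sum>j\<in>T. ?Z j \<xi>)"
      using sum_bounded_below[of T \<tau> "\<lambda>j. ?Z j \<xi>"] T(2) by simp
    have "(?\<kappa> * s / 8) * \<tau> \<le> l * \<tau>" using l_ge \<tau>0 by (intro mult_right_mono)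
    moreover have "4 * sqrt s \<le> ?\<kappa> / 16 * s * \<tau>"
    proof -
      \<comment> \<open>The origin of 8192: with ln m at least 2/3 the product exceeds 4096 = 64^2.
        The 64 is what 4 * sqrt s needs to cost at most half of the gain \<open>tail_const\<close> /
        8 * s * \<tau>.\<close>
      have "8192 * (2/3) \<le> (?\<kappa>\<^sup>2 * s) * ln m" using ks2 ln2 by (intro mult_mono) auto
      then have "64\<^sup>2 \<le> (?\<kappa> * sqrt s * \<tau>)\<^sup>2" by (simp add: power_mult_distrib \<tau>2)
      then have "64 \<le> ?\<kappa> * sqrt s * \<tau>"
        by (rule power2_le_imp_le) (use kp \<tau>0 in auto)
      then have "64 * sqrt s \<le> ?\<kappa> * sqrt s * \<tau> * sqrt s" by (intro mult_right_mono) auto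
      moreover have "?\<kappa> * sqrt s * \<tau> * sqrt s = ?\<kappa> * \<tau> * (sqrt s * sqrt s)" by (simp only: ac_simps)
      moreover have "?\<kappa> / 16 * s * \<tau> = ?\<kappa> * \<tau> * s / 16" by simp
      ultimately show ?thesis unfolding real_sqrt_mult_self abs_of_nat by linarith
    qed
    ultimately have "?\<kappa> / 16 * s * \<tau> \<le> l * \<tau> - 4 * sqrt s" by (simp add: algebra_simps)
    also have "\<dots> \<le> (\<Sum>j\<in>F \<union> T. ?Z j \<xi>)"
      using sumF sumT disj finT by (subst sum.union_disjoint) (auto simp: F_def)
    finally have "?\<kappa> / 16 * s * sqrt (ln m) \<le> (\<Sum>j\<in>F \<union> T. ?Z j \<xi>)" by (simp add: \<tau>_def)
    moreover have "F \<union> T \<subseteq> {..<k}" using T sk by (auto simp: F_def R_def)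
    moreover have "card (F \<union> T) = s - 1"
      using disj finT T ls by (subst card_Un_disjoint) (auto simp: F_def)
    ultimately show "\<exists>D \<subseteq> {..<k}. card D = s - 1 \<and>
        ?\<kappa> / 16 * s * sqrt (ln m) \<le> (\<Sum>j\<in>D. ?Z j \<xi>)"
      by (intro exI[of _ "F \<union> T"] conjI)
  qed
qed

section \<open>The vectors \<open>w\<close> for the target Gram matrix\<close>

lemma pick_bij_betw:
  assumes "finite S"
  shows "bij_betw (pick S) {..<card S} S"
  using assms
  by (intro bij_betw_byWitness[where f' = "\<lambda>i. card {a \<in> S. a < i}"])
    (auto simp: card_pick pick_card_in_set pick_in_set intro!: psubset_card_mono)

text \<open>Resolves the option type in \<open>posi_v\<close>: a trivial kernel gives a nonzero
  determinant, hence a unit of the matrix ring, so the computed inverse exists.\<close>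

lemma mat_inverse_nonsingular:
  fixes G :: "real mat"
  assumes G: "G \<in> carrier_mat d d"
    and inj: "\<And>v. v \<in> carrier_vec d \<Longrightarrow> G *\<^sub>v v = 0\<^sub>v d \<Longrightarrow> v = 0\<^sub>v d"
  obtains B where "mat_inverse G = Some B" "B \<in> carrier_mat d d" "G * B = 1\<^sub>m d"
proof -
  have "det G \<noteq> 0" using inj by (auto simp: det_0_iff_vec_prod_zero[OF G])
  then have "G \<in> Units (ring_mat TYPE(real) d ())" by (rule det_non_zero_imp_unit[OF G])
  then obtain B where "mat_inverse G = Some B" using mat_inverse(1)[OF G, where b = "()"] by (cases "mat_inverse G") auto
  with mat_inverse(2)[OF G this] show ?thesis by (intro that) auto
qed

text \<open>Instead of inverting the Gram matrix G one solves G y = e for a single basis vector. The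
  squared norm of X_M y is the scalar product of G y and y, that is, one entry of y.\<close>

lemma posi_v_eqI:
  assumes XM: "cols_submatrix X M \<in> carrier_mat n d" and d: "card M = d" and r: "rank_in i M < d"
    and inj: "\<And>v. v \<in> carrier_vec d \<Longrightarrow>
      (transpose_mat (cols_submatrix X M) * cols_submatrix X M) *\<^sub>v v = 0\<^sub>v d \<Longrightarrow> v = 0\<^sub>v d"
    and y: "y \<in> carrier_vec d"
    and eq: "(transpose_mat (cols_submatrix X M) * cols_submatrix X M) *\<^sub>v y = unit_vec d (rank_in i M)"
  shows "posi_v X M i = cols_submatrix X M *\<^sub>v y"
    and "posi_v X M i \<bullet> posi_v X M i = y $ rank_in i M"
proof -
  let ?XM = "cols_submatrix X M"
  define G where "G = transpose_mat ?XM * ?XM"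
  have G: "G \<in> carrier_mat d d" unfolding G_def using XM by auto
  have Gt: "transpose_mat G = G" unfolding G_def using XM by (simp add: transpose_mult[of _ d n _ d])
  obtain B where B: "mat_inverse G = Some B" "B \<in> carrier_mat d d" "G * B = 1\<^sub>m d"
    using mat_inverse_nonsingular[OF G] inj unfolding G_def by blast
  have Bt: "transpose_mat B \<in> carrier_mat d d" using B by simp
  have BG: "transpose_mat B * G = 1\<^sub>m d"
    using arg_cong[OF B(3), of transpose_mat] transpose_mult[OF G B(2)] Gt by simp
  have "posi_v X M i = transpose_mat (B * transpose_mat ?XM) *\<^sub>v unit_vec d (rank_in i M)"
    unfolding posi_v_def Let_def G_def[symmetric] B(1) d by simp
  also have "transpose_mat (B * transpose_mat ?XM) = ?XM * transpose_mat B"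
    using transpose_mult[OF B(2), of "transpose_mat ?XM" n] XM by simp
  also have "(?XM * transpose_mat B) *\<^sub>v unit_vec d (rank_in i M) =
      ?XM *\<^sub>v (transpose_mat B *\<^sub>v (G *\<^sub>v y))"
    using XM Bt eq by (simp add: G_def assoc_mult_mat_vec[of _ n d _ d])
  also have "transpose_mat B *\<^sub>v (G *\<^sub>v y) = y"
    using assoc_mult_mat_vec[OF Bt G y] BG y by simp
  finally show v: "posi_v X M i = ?XM *\<^sub>v y" .
  have "(?XM *\<^sub>v y) \<bullet> (?XM *\<^sub>v y) = (transpose_mat ?XM *\<^sub>v (?XM *\<^sub>v y)) \<bullet> y"
    using XM y by (intro transpose_vec_mult_scalar[symmetric]) auto
  also have "transpose_mat ?XM *\<^sub>v (?XM *\<^sub>v y) = unit_vec d (rank_in i M)"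
    using XM y eq by (simp add: assoc_mult_mat_vec[of _ d n _ d])
  also have "unit_vec d (rank_in i M) \<bullet> y = y $ rank_in i M"
    using y r by (simp add: scalar_prod_left_unit)
  finally show "posi_v X M i \<bullet> posi_v X M i = y $ rank_in i M" unfolding v .
qed

lemma gram_entry:
  assumes "X \<in> carrier_mat n p" "i < p" "j < p"
  shows "(transpose_mat X * X) $$ (i, j) = (\<Sum>a<n. X $$ (a, i) * X $$ (a, j))"
  using assms by (simp add: scalar_prod_def lessThan_atLeast0)

lemma target_gram_entry:
  assumes "k < p"
  shows "i < k \<Longrightarrow> j < k \<Longrightarrow> target_gram k (p - k - 1) c $$ (i, j) = (if i = j then 1 else 0)"
    and "i < k \<Longrightarrow> target_gram k (p - k - 1) c $$ (i, p - 1) = c"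
    and "i < k \<Longrightarrow> target_gram k (p - k - 1) c $$ (p - 1, i) = c"
    and "target_gram k (p - k - 1) c $$ (p - 1, p - 1) = 1"
  using assms by (auto simp: target_gram_def append_rows_def const_mat_def)

text \<open>The selected Gram matrix is an identity bordered by c, with p - 1 in the last position
  because it is the largest index. The Schur complement of the identity block is
  \<open>\<sigma>\<close>, and the squared norm of v is 1 / \<open>\<sigma>\<close>.\<close>

lemma posi_w_target_gram:
  assumes X: "X \<in> carrier_mat n p" and k: "k < p"
    and gram: "transpose_mat X * X = target_gram k (p - k - 1) c"
    and D: "D \<subseteq> {..<k}" and pos: "0 < 1 - real (card D) * c\<^sup>2"
  shows "posi_w X (insert (p - 1) D) (p - 1) \<bullet> Matrix.vec n \<xi> =
    ((\<Sum>a<n. X $$ (a, p - 1) * \<xi> a) - c * (\<Sum>j\<in>D. \<Sum>a<n. X $$ (a, j) * \<xi> a)) /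
      sqrt (1 - real (card D) * c\<^sup>2)"
proof -
  define M where "M = insert (p - 1) D"
  define r where "r = card D"
  define \<sigma> where "\<sigma> = 1 - real r * c\<^sup>2"
  let ?XM = "cols_submatrix X M"
  let ?G = "transpose_mat ?XM * ?XM"
  have finD: "finite D" using D finite_subset by blast
  have pD: "p - 1 \<notin> D" using D k by auto
  have d: "card M = Suc r" using finD pD by (simp add: M_def r_def)
  have Mp: "M \<subseteq> {..<p}" using D k by (auto simp: M_def)
  have finM: "finite M" using finD by (simp add: M_def)
  have rank: "rank_in (p - 1) M = r"
  proof -
    have "{j \<in> M. j < p - 1} = D" using D k by (auto simp: M_def)
    then show ?thesis by (simp add: rank_in_def r_def)
  qed
  have pick_r: "pick M r = p - 1"
    using pick_card_in_set[of "p - 1" M] rank by (simp add: rank_in_def M_def)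
  have bij: "bij_betw (pick M) {..<Suc r} M" using pick_bij_betw[OF finM] d by simp
  have bijD: "bij_betw (pick M) {..<r} D"
  proof -
    have "bij_betw (pick M) ({..<Suc r} - {r}) (M - {pick M r})"
      using bij by (intro bij_betw_DiffI) (auto simp: bij_betw_def)
    moreover have "{..<Suc r} - {r} = {..<r}" by auto
    moreover have "M - {pick M r} = D" unfolding pick_r using pD by (auto simp: M_def)
    ultimately show ?thesis by simp
  qed
  have pickD: "pick M a < k" if "a < r" for a
    using bijD that D by (auto simp: bij_betw_def)
  have colset: "{j. j < p \<and> j \<in> M} = M" using Mp by auto
  have XM: "?XM \<in> carrier_mat n (Suc r)"
    unfolding cols_submatrix_def using X d
    by (intro carrier_matI) (simp_all add: dim_submatrix colset)
  have XMe: "?XM $$ (a, b) = X $$ (a, pick M b)" if "a < n" "b < Suc r" for a b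
    unfolding cols_submatrix_def using that X d colset
    by (subst submatrix_index) (auto simp: pick_UNIV)
  have Xgram: "(\<Sum>a<n. X $$ (a, i) * X $$ (a, j)) = target_gram k (p - k - 1) c $$ (i, j)"
    if "i < p" "j < p" for i j
    using gram_entry[OF X that] unfolding gram by simp
  have Ge: "?G $$ (a, b) = (if a = b then 1 else if a = r \<or> b = r then c else 0)"
    if "a < Suc r" "b < Suc r" for a b
  proof -
    have "?G $$ (a, b) = (\<Sum>t<n. X $$ (t, pick M a) * X $$ (t, pick M b))"
      using that XM XMe by (simp add: scalar_prod_def lessThan_atLeast0)
    also have "\<dots> = target_gram k (p - k - 1) c $$ (pick M a, pick M b)"
      using bij Mp that by (intro Xgram) (auto simp: bij_betw_def)
    also have "\<dots> = (if a = b then 1 else if a = r \<or> b = r then c else 0)"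
    proof (cases "a = r \<or> b = r")
      case True
      then show ?thesis
        using that target_gram_entry[OF k] pickD pick_r by (auto simp: less_Suc_eq)
    next
      case False
      then have ab: "a < r" "b < r" using that by auto
      then have "pick M a = pick M b \<longleftrightarrow> a = b" using bijD by (auto simp: bij_betw_def inj_on_def)
      then show ?thesis using ab target_gram_entry(1)[OF k] pickD by simp
    qed
    finally show ?thesis .
  qed
  have G: "?G \<in> carrier_mat (Suc r) (Suc r)" using XM by auto
  have Gv: "(?G *\<^sub>v v) $ a = (if a < r then v $ a + c * v $ r else c * (\<Sum>b<r. v $ b) + v $ r)"
    if "a < Suc r" "v \<in> carrier_vec (Suc r)" for a v
  proof -
    have "(?G *\<^sub>v v) $ a = (\<Sum>b<Suc r. ?G $$ (a, b) * v $ b)"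
      using that G by (simp add: scalar_prod_def lessThan_atLeast0 del: sum.op_ivl_Suc index_mult_mat)
    also have "\<dots> = (\<Sum>b<Suc r. (if a = b then 1 else if a = r \<or> b = r then c else 0) * v $ b)"
      using that Ge by (intro sum.cong refl) (simp del: index_mult_mat)
    also have "\<dots> = (if a < r then v $ a + c * v $ r else c * (\<Sum>b<r. v $ b) + v $ r)"
    proof (cases "a < r")
      case True
      have "(\<Sum>b<r. (if a = b then 1 else if a = r \<or> b = r then c else 0) * v $ b) =
         (\<Sum>b<r. if a = b then v $ b else 0)"
        using True by (intro sum.cong) auto
      also have "\<dots> = v $ a" using True by simp
      finally show ?thesis using True by simp
    next
      case False
      then have "a = r" using that by simp
      moreover have "(\<Sum>b<r. (if r = b then 1 else if r = r \<or> b = r then c else 0) * v $ b) =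
         (\<Sum>b<r. c * v $ b)"
        by (intro sum.cong) auto
      ultimately show ?thesis by (simp add: sum_distrib_left)
    qed
    finally show ?thesis .
  qed
  have \<sigma>: "0 < \<sigma>" using pos by (simp add: \<sigma>_def r_def)
  \<comment> \<open>Block elimination: the first r rows express the entries through the last one,
    and the last row becomes \<open>\<sigma>\<close> * v_r = 0. The same elimination with right-hand
    side e_r yields the vector \<open>y\<close> below.\<close>
  have inj: "v = 0\<^sub>v (Suc r)" if v: "v \<in> carrier_vec (Suc r)" and "?G *\<^sub>v v = 0\<^sub>v (Suc r)" for v
  proof -
    have 0: "(?G *\<^sub>v v) $ a = 0" if "a < Suc r" for a using that \<open>?G *\<^sub>v v = 0\<^sub>v (Suc r)\<close> by simp
    have low: "v $ a = - c * v $ r" if "a < r" for a using 0[of a] Gv[of a v] v that by simp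
    have "c * (\<Sum>b<r. v $ b) + v $ r = 0" using 0[of r] Gv[of r v] v by simp
    moreover have "(\<Sum>b<r. v $ b) = - (real r * c * v $ r)" using low by simp
    ultimately have "\<sigma> * v $ r = 0" by (simp add: \<sigma>_def power2_eq_square algebra_simps)
    then have "v $ r = 0" using \<sigma> by simp
    then have "v $ a = 0" if "a < Suc r" for a using low[of a] that by (auto simp: less_Suc_eq)
    then show ?thesis using v by (intro eq_vecI) auto
  qed
  define y where "y = Matrix.vec (Suc r) (\<lambda>a. if a = r then 1 / \<sigma> else - c / \<sigma>)"
  have y: "y \<in> carrier_vec (Suc r)" by (simp add: y_def)
  have Gy: "?G *\<^sub>v y = unit_vec (Suc r) r"
  proof (rule eq_vecI)
    fix a assume "a < dim_vec (unit_vec (Suc r) r :: real vec)"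
    then have a: "a < Suc r" by simp
    show "(?G *\<^sub>v y) $ a = unit_vec (Suc r) r $ a"
    proof (cases "a < r")
      case True
      then show ?thesis using Gv[OF a y] by (simp add: y_def)
    next
      case False
      then have "a = r" using a by simp
      moreover have "c * (\<Sum>b<r. y $ b) + y $ r = (1 - real r * c\<^sup>2) / \<sigma>"
        by (simp add: y_def power2_eq_square diff_divide_distrib)
      ultimately show ?thesis using Gv[OF a y] \<sigma> by (simp add: \<sigma>_def)
    qed
  qed (use XM in auto)
  have rk: "rank_in (p - 1) M < Suc r" "?G *\<^sub>v y = unit_vec (Suc r) (rank_in (p - 1) M)"
    unfolding rank using Gy by auto
  have yr: "y $ r = 1 / \<sigma>" by (simp add: y_def)
  have pv: "posi_v X M (p - 1) = ?XM *\<^sub>v y"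
    and pv2: "posi_v X M (p - 1) \<bullet> posi_v X M (p - 1) = 1 / \<sigma>"
    using posi_v_eqI[OF XM d rk(1) inj y rk(2)] by (simp_all only: rank yr)
  have nz: "posi_v X M (p - 1) \<noteq> 0\<^sub>v n" using pv2 \<sigma> by auto
  have dn: "dim_row X = n" using X by simp
  have pvc: "posi_v X M (p - 1) \<in> carrier_vec n" unfolding pv using XM y by auto
  have pve: "posi_v X M (p - 1) $ a = (X $$ (a, p - 1) - c * (\<Sum>j\<in>D. X $$ (a, j))) / \<sigma>" if "a < n" for a
  proof -
    have "posi_v X M (p - 1) $ a = (\<Sum>b<Suc r. X $$ (a, pick M b) * y $ b)"
      unfolding pv using XM y that XMe
      by (simp add: scalar_prod_def lessThan_atLeast0 del: sum.op_ivl_Suc)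
    also have "\<dots> = (\<Sum>b<r. - c / \<sigma> * X $$ (a, pick M b)) + X $$ (a, p - 1) / \<sigma>"
      by (simp add: y_def pick_r mult.commute)
    also have "(\<Sum>b<r. - c / \<sigma> * X $$ (a, pick M b)) = (\<Sum>j\<in>D. - c / \<sigma> * X $$ (a, j))"
      by (rule sum.reindex_bij_betw[OF bijD])
    finally show ?thesis by (simp add: sum_distrib_left diff_divide_distrib sum_negf sum_divide_distrib)
  qed
  have "posi_w X M (p - 1) \<bullet> Matrix.vec n \<xi> =
      1 / euclid_norm (posi_v X M (p - 1)) * (posi_v X M (p - 1) \<bullet> Matrix.vec n \<xi>)"
    using nz pvc by (simp add: posi_w_def Let_def dn)
  also have "1 / euclid_norm (posi_v X M (p - 1)) = sqrt \<sigma>"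
    unfolding euclid_norm_def pv2 by (simp add: real_sqrt_divide)
  also have "posi_v X M (p - 1) \<bullet> Matrix.vec n \<xi> =
     (\<Sum>a<n. (X $$ (a, p - 1) - c * (\<Sum>j\<in>D. X $$ (a, j))) * \<xi> a) / \<sigma>"
    using pve by (simp add: scalar_prod_def lessThan_atLeast0 sum_divide_distrib)
  also have "(\<Sum>a<n. (X $$ (a, p - 1) - c * (\<Sum>j\<in>D. X $$ (a, j))) * \<xi> a) =
     (\<Sum>a<n. X $$ (a, p - 1) * \<xi> a) - c * (\<Sum>j\<in>D. \<Sum>a<n. X $$ (a, j) * \<xi> a)"
  proof -
    have "(\<Sum>j\<in>D. \<Sum>a<n. X $$ (a, j) * \<xi> a) = (\<Sum>a<n. (\<Sum>j\<in>D. X $$ (a, j)) * \<xi> a)"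
      unfolding sum_distrib_right by (rule sum.swap)
    then show ?thesis by (simp only: left_diff_distrib sum_subtractf sum_distrib_left[symmetric] mult.assoc)
  qed
  also have "sqrt \<sigma> * (R / \<sigma>) = R / sqrt \<sigma>" for R
  proof -
    have "sqrt \<sigma> / \<sigma> = 1 / sqrt \<sigma>" using \<sigma> by (simp add: field_simps)
    then have "R * (sqrt \<sigma> / \<sigma>) = R * (1 / sqrt \<sigma>)" by (rule arg_cong)
    then show ?thesis by (simp add: mult.commute)
  qed
  finally show ?thesis by (simp add: \<sigma>_def r_def M_def)
qed

section \<open>Lower bounds for the PoSI constant\<close>

text \<open>If t < T, then the event f <= t lies inside \<open>bad\<close> and has probability below
  q, so t is not a candidate in the infimum.\<close>

lemma (in prob_space) quantile_ge:
  assumes f [measurable]: "f \<in> borel_measurable M" and q: "q < 1"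
    and bad: "bad \<in> events" "prob bad < q"
    and T: "\<And>\<omega>. \<omega> \<in> space M \<Longrightarrow> \<omega> \<notin> bad \<Longrightarrow> T \<le> f \<omega>"
  shows "T \<le> quantile M f q"
  unfolding quantile_def
proof (rule cInf_greatest)
  \<comment> \<open>The infimum over an empty set of reals would carry no information. Since f is
    finite everywhere and q < 1, some natural number is a candidate.\<close>
  have "(\<lambda>i. prob {\<omega> \<in> space M. f \<omega> \<le> real i}) \<longlonglongrightarrow> prob (\<Union>i. {\<omega> \<in> space M. f \<omega> \<le> real i})"
    by (intro finite_Lim_measure_incseq) (auto simp: incseq_def intro: order_trans)
  moreover have "(\<Union>i. {\<omega> \<in> space M. f \<omega> \<le> real i}) = space M"
    using real_arch_simple by blast
  ultimately have "(\<lambda>i. prob {\<omega> \<in> space M. f \<omega> \<le> real i}) \<longlonglongrightarrow> 1" by (simp add: prob_space)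
  from order_tendstoD(1)[OF this q] obtain i where "q < prob {\<omega> \<in> space M. f \<omega> \<le> real i}"
    by (auto simp: eventually_sequentially)
  then have "real i \<in> {t. q \<le> prob {\<omega> \<in> space M. f \<omega> \<le> t}}" by simp
  then show "{t. q \<le> prob {\<omega> \<in> space M. f \<omega> \<le> t}} \<noteq> {}" by blast
next
  fix t assume t: "t \<in> {t. q \<le> prob {\<omega> \<in> space M. f \<omega> \<le> t}}"
  show "T \<le> t"
  proof (rule ccontr)
    assume "\<not> T \<le> t"
    then have "{\<omega> \<in> space M. f \<omega> \<le> t} \<subseteq> bad" using T by force
    then have "prob {\<omega> \<in> space M. f \<omega> \<le> t} \<le> prob bad" using bad(1) by (rule finite_measure_mono)
    then show False using t bad(2) by simp
  qed
qed

text \<open>Rewriting over one fixed finite index set makes measurability and the comparison with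
  single terms instances of facts on finite maxima.\<close>

lemma posi_max_image:
  "posi_max X (models p s) = (\<lambda>\<xi>. Max ((\<lambda>(M, i). \<bar>posi_w X M i \<bullet> Matrix.vec (dim_row X) \<xi>\<bar>) `
    Sigma (models p s) (\<lambda>M. M)))"
proof
  fix \<xi>
  have "{\<bar>posi_w X M i \<bullet> Matrix.vec (dim_row X) \<xi>\<bar> | M i. M \<in> models p s \<and> i \<in> M} =
    (\<lambda>(M, i). \<bar>posi_w X M i \<bullet> Matrix.vec (dim_row X) \<xi>\<bar>) ` Sigma (models p s) (\<lambda>M. M)"
    by (auto simp: image_def)
  then show "posi_max X (models p s) \<xi> = Max ((\<lambda>(M, i). \<bar>posi_w X M i \<bullet> Matrix.vec (dim_row X) \<xi>\<bar>) `
    Sigma (models p s) (\<lambda>M. M))"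
    by (simp add: posi_max_def)
qed

lemma finite_Sigma_models: "finite (Sigma (models p s) (\<lambda>M. M))"
proof -
  have "models p s \<subseteq> Pow {0..<p}" by (auto simp: models_def)
  then show ?thesis
    by (intro finite_SigmaI) (auto simp: models_def intro: finite_subset)
qed

lemma borel_measurable_posi_max [measurable]:
  "posi_max X (models p s) \<in> borel_measurable (std_gaussian (dim_row X))"
proof -
  have "(\<lambda>\<xi>. \<bar>posi_w X M i \<bullet> Matrix.vec (dim_row X) \<xi>\<bar>) \<in> borel_measurable (std_gaussian (dim_row X))" for M i
    using measurable_linear_std_gaussian[of "\<lambda>j. posi_w X M i $ j" "dim_row X"]
    by (simp add: scalar_prod_def lessThan_atLeast0)
  then show ?thesis
    unfolding posi_max_image using finite_Sigma_models
    by (intro borel_measurable_Max) (auto simp: case_prod_beta)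
qed

lemma posi_max_ge:
  assumes "M \<in> models p s" "i \<in> M"
  shows "\<bar>posi_w X M i \<bullet> Matrix.vec (dim_row X) \<xi>\<bar> \<le> posi_max X (models p s) \<xi>"
  unfolding posi_max_image using finite_Sigma_models assms
  by (intro Max_ge) force+

lemma posi_K_ge:
  assumes "0 < \<alpha>" "bad \<in> sets (std_gaussian (dim_row X))"
    and "measure (std_gaussian (dim_row X)) bad < 1 - \<alpha>"
    and "\<And>\<xi>. \<xi> \<in> space (std_gaussian (dim_row X)) \<Longrightarrow> \<xi> \<notin> bad \<Longrightarrow> T \<le> posi_max X (models p s) \<xi>"
  shows "T \<le> posi_K X (models p s) \<alpha>"
proof -
  interpret prob_space "std_gaussian (dim_row X)" by (rule prob_space_std_gaussian)
  show ?thesis unfolding posi_K_def using assms by (intro quantile_ge) auto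
qed

lemma posi_K_nonneg:
  assumes "0 < \<alpha>" "\<alpha> < 1" "0 < p" "0 < s"
  shows "0 \<le> posi_K X (models p s) \<alpha>"
proof (rule posi_K_ge[where bad = "{}"])
  fix \<xi>
  have "{0} \<in> models p s" using assms by (simp add: models_def)
  from posi_max_ge[OF this, of 0 X \<xi>] show "0 \<le> posi_max X (models p s) \<xi>" by simp
qed (use assms in auto)

text \<open>Whatever the sign of the last coordinate, one of the two one-sided subset sums has the
  right sign; this is where the absolute value in the definition of the PoSI constant is used.\<close>

lemma posi_K_target_gram_ge:
  fixes n p s k :: nat
  assumes "2 \<le> s" and smk: "s * m \<le> k" and "2 \<le> m" and k: "k < p"
    and s: "8192 / tail_const\<^sup>2 \<le> s"
    and c: "0 \<le> c" "real (s - 1) * c\<^sup>2 < 1" and \<alpha>: "0 < \<alpha>" "\<alpha> \<le> 1/2"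
    and X: "X \<in> carrier_mat n p"
    and gram: "transpose_mat X * X = target_gram k (p - k - 1) c"
  shows "c * (tail_const / 16 * s * sqrt (ln m)) / sqrt (1 - real (s - 1) * c\<^sup>2) \<le> posi_K X (models p s) \<alpha>"
proof -
  interpret prob_space "std_gaussian n" by (rule prob_space_std_gaussian)
  let ?Z = "\<lambda>j \<xi>. \<Sum>a<n. X $$ (a, j) * \<xi> a"
  let ?h = "tail_const / 16 * s * sqrt (ln m)"
  let ?\<sigma> = "sqrt (1 - real (s - 1) * c\<^sup>2)"
  have dn: "dim_row X = n" using X by simp
  have \<sigma>: "0 < ?\<sigma>" using c by simp
  have orth: "(\<Sum>a<n. X $$ (a, i) * X $$ (a, j)) = (if i = j then 1 else 0)" if "i < k" "j < k" for i j
    using gram_entry[OF X, of i j] target_gram_entry(1)[OF k that] that k unfolding gram by simp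
  obtain bad1 where bad1: "bad1 \<in> events" "prob bad1 \<le> 1/8"
    "\<And>\<xi>. \<xi> \<in> space (std_gaussian n) \<Longrightarrow> \<xi> \<notin> bad1 \<Longrightarrow>
      \<exists>D \<subseteq> {..<k}. card D = s - 1 \<and> ?h \<le> (\<Sum>j\<in>D. ?Z j \<xi>)"
    using orthonormal_large_subset_sum[where n = n and u = "\<lambda>j a. X $$ (a, j)", OF orth \<open>2 \<le> m\<close> smk s] by blast
  \<comment> \<open>The negated columns are again orthonormal, so the same lemma provides subset
    sums that are large and negative.\<close>
  obtain bad2 where bad2: "bad2 \<in> events" "prob bad2 \<le> 1/8"
    "\<And>\<xi>. \<xi> \<in> space (std_gaussian n) \<Longrightarrow> \<xi> \<notin> bad2 \<Longrightarrow>
      \<exists>D \<subseteq> {..<k}. card D = s - 1 \<and> ?h \<le> (\<Sum>j\<in>D. \<Sum>a<n. - X $$ (a, j) * \<xi> a)"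
    using orthonormal_large_subset_sum[where n = n and u = "\<lambda>j a. - X $$ (a, j)", OF _ \<open>2 \<le> m\<close> smk s] orth
    by (simp only: minus_mult_minus) blast
  have max_ge: "\<bar>?Z (p - 1) \<xi> - c * (\<Sum>j\<in>D. ?Z j \<xi>)\<bar> / ?\<sigma> \<le> posi_max X (models p s) \<xi>"
    if D: "D \<subseteq> {..<k}" "card D = s - 1" for D \<xi>
  proof -
    have "finite D" using D(1) finite_subset by blast
    moreover have "p - 1 \<notin> D" using D k by auto
    ultimately have "insert (p - 1) D \<in> models p s" using D k \<open>2 \<le> s\<close> by (auto simp: models_def)
    from posi_max_ge[OF this, of "p - 1" X \<xi>]
    show ?thesis
      using posi_w_target_gram[OF X k gram D(1), of \<xi>] c \<sigma> D(2) by (simp add: dn)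
  qed
  show ?thesis
  proof (rule posi_K_ge)
    show "bad1 \<union> bad2 \<in> sets (std_gaussian (dim_row X))" using bad1(1) bad2(1) by (simp add: dn)
    \<comment> \<open>The two exceptional events have total probability at most 1/4, while 1 -
      \<alpha> is at least 1/2.\<close>
    show "measure (std_gaussian (dim_row X)) (bad1 \<union> bad2) < 1 - \<alpha>"
      using measure_Un_le[OF bad1(1) bad2(1)] bad1(2) bad2(2) \<alpha> by (simp add: dn)
    fix \<xi> assume \<xi>: "\<xi> \<in> space (std_gaussian (dim_row X))" "\<xi> \<notin> bad1 \<union> bad2"
    have "\<exists>D \<subseteq> {..<k}. card D = s - 1 \<and> c * ?h \<le> \<bar>?Z (p - 1) \<xi> - c * (\<Sum>j\<in>D. ?Z j \<xi>)\<bar>"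
    proof (cases "0 \<le> ?Z (p - 1) \<xi>")
      case True
      obtain D where D: "D \<subseteq> {..<k}" "card D = s - 1" "?h \<le> (\<Sum>j\<in>D. \<Sum>a<n. - X $$ (a, j) * \<xi> a)"
        using bad2(3)[of \<xi>] \<xi> dn by auto
      have "?h \<le> - (\<Sum>j\<in>D. ?Z j \<xi>)" using D(3) by (simp add: sum_negf)
      then have "c * ?h \<le> c * - (\<Sum>j\<in>D. ?Z j \<xi>)" using c by (intro mult_left_mono)
      then have "c * ?h \<le> \<bar>?Z (p - 1) \<xi> - c * (\<Sum>j\<in>D. ?Z j \<xi>)\<bar>" using True by linarith
      with D show ?thesis by blast
    next
      case False
      obtain D where D: "D \<subseteq> {..<k}" "card D = s - 1" "?h \<le> (\<Sum>j\<in>D. ?Z j \<xi>)"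
        using bad1(3)[of \<xi>] \<xi> dn by auto
      then have "c * ?h \<le> c * (\<Sum>j\<in>D. ?Z j \<xi>)" using c by (intro mult_left_mono)
      then have "c * ?h \<le> \<bar>?Z (p - 1) \<xi> - c * (\<Sum>j\<in>D. ?Z j \<xi>)\<bar>" using False by linarith
      with D show ?thesis by blast
    qed
    then obtain D where D: "D \<subseteq> {..<k}" "card D = s - 1"
      "c * ?h \<le> \<bar>?Z (p - 1) \<xi> - c * (\<Sum>j\<in>D. ?Z j \<xi>)\<bar>" by blast
    have "c * ?h / ?\<sigma> \<le> \<bar>?Z (p - 1) \<xi> - c * (\<Sum>j\<in>D. ?Z j \<xi>)\<bar> / ?\<sigma>"
      using D(3) \<sigma> by (intro divide_right_mono) auto
    also have "\<dots> \<le> posi_max X (models p s) \<xi>" by (rule max_ge[OF D(1,2)])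
    finally show "c * ?h / ?\<sigma> \<le> posi_max X (models p s) \<xi>" .
  qed (rule \<alpha>)
qed

text \<open>The subtracted \<open>sqrt (2 * ln 2) \<ge> 1\<close> absorbs all bounded values of \<open>s\<close>, since \<open>c\<^sup>2 * k < 1\<close> makes
  the main term at most of order \<open>s\<close>.\<close>

theorem proposition4p2:
  shows "\<exists>A::real. A > 0 \<and>
    (\<forall>(n::nat) (p::nat) (s::nat) (k::nat) (c::real) (\<alpha>::real) (X::real mat).
      n > 0 \<longrightarrow> p > 0 \<longrightarrow> s > 0 \<longrightarrow> k > 0 \<longrightarrow> s \<le> k \<longrightarrow> k < p \<longrightarrow>
      c\<^sup>2 < 1 / real k \<longrightarrow> 0 < \<alpha> \<longrightarrow> \<alpha> \<le> 1/2 \<longrightarrow>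
      X \<in> carrier_mat n p \<longrightarrow>
      transpose_mat X * X = target_gram k (p - k - 1) c \<longrightarrow>
      posi_K X (models p s) \<alpha> \<ge>
        A * (c * (real s - 1) / sqrt (1 - (real s - 1) * c\<^sup>2))
          * sqrt (ln (of_int \<lfloor>real k / real s\<rfloor>))
        - sqrt (2 * ln 2))"
proof (intro exI[of _ "tail_const\<^sup>2 / 16384"] conjI allI impI)
  show "0 < tail_const\<^sup>2 / 16384" using tail_const_pos by simp
  fix n p s k :: nat and c \<alpha> :: real and X :: "real mat"
  assume p: "p > 0" and s: "s > 0" and k: "k > 0" and sk: "s \<le> k" and kp: "k < p"
    and ck: "c\<^sup>2 < 1 / real k" and \<alpha>: "0 < \<alpha>" "\<alpha> \<le> 1/2" and X: "X \<in> carrier_mat n p"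
    and gram: "transpose_mat X * X = target_gram k (p - k - 1) c"
  define m where "m = k div s"
  \<comment> \<open>This is the reciprocal of 2 * (8192 / \<open>tail_const\<close>^2), the bound on
    the main term for small s. For large s the weaker requirement A <= \<open>tail_const\<close> /
    16 suffices.\<close>
  define A where "A = tail_const\<^sup>2 / 16384"
  define \<sigma> where "\<sigma> = 1 - (real s - 1) * c\<^sup>2"
  define L where "L = sqrt (ln (real m))"
  have m_floor: "of_int \<lfloor>real k / real s\<rfloor> = real m"
    by (simp add: m_def floor_divide_of_nat_eq)
  have A: "0 < A" using tail_const_pos by (simp add: A_def)
  have m1: "1 \<le> m" using s sk by (simp add: m_def div_greater_zero_iff Suc_le_eq)
  have smk: "s * m \<le> k" by (simp add: m_def)
  have L0: "0 \<le> L" using m1 by (simp add: L_def)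
  have ck1: "real k * c\<^sup>2 < 1" using ck k by (simp add: field_simps)
  have "(real s - 1) * c\<^sup>2 \<le> real k * c\<^sup>2" using sk by (intro mult_right_mono) auto
  then have \<sigma>: "0 < \<sigma>" using ck1 by (simp add: \<sigma>_def)
  have K0: "0 \<le> posi_K X (models p s) \<alpha>" using posi_K_nonneg \<alpha> p s by simp
  have ln2: "1 \<le> sqrt (2 * ln (2::real))" using ln2_ge_two_thirds by simp
  have "A * (c * (real s - 1) / sqrt \<sigma>) * L - sqrt (2 * ln 2) \<le> posi_K X (models p s) \<alpha>"
  proof (cases "c \<le> 0 \<or> s = 1 \<or> m = 1")
    case True
    \<comment> \<open>Degenerate cases: a factor is nonpositive, or the logarithm is ln 1 = 0.
      Nonnegativity of the PoSI constant then suffices.\<close>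
    then have "(c * (real s - 1) / sqrt \<sigma>) * L \<le> 0"
      using L0 \<sigma> s by (auto simp: L_def mult_nonpos_nonneg divide_nonpos_nonneg)
    then have "A * ((c * (real s - 1) / sqrt \<sigma>) * L) \<le> 0"
      by (rule mult_nonneg_nonpos[OF less_imp_le[OF A]])
    then have "A * (c * (real s - 1) / sqrt \<sigma>) * L \<le> 0" by (simp only: mult.assoc)
    then show ?thesis using K0 ln2 by linarith
  next
    case False
    then have c0: "0 < c" and s2: "2 \<le> s" and m2: "2 \<le> m" using s m1 by auto
    show ?thesis
    proof (cases "8192 / tail_const\<^sup>2 \<le> s")
      case True
      have rs: "real (s - 1) = real s - 1" using s by (simp add: of_nat_diff)
      have "c * (tail_const / 16 * s * L) / sqrt \<sigma> \<le> posi_K X (models p s) \<alpha>"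
        using posi_K_target_gram_ge[OF s2 smk m2 kp True _ _ \<alpha> X gram, unfolded rs] c0 \<sigma>
        by (simp add: \<sigma>_def L_def)
      moreover have "A * (c * (real s - 1) / sqrt \<sigma>) * L \<le> c * (tail_const / 16 * s * L) / sqrt \<sigma>"
      proof -
        have "tail_const\<^sup>2 \<le> tail_const"
          using tail_const_pos tail_const_le_1 by (simp add: power2_eq_square mult_left_le)
        then have "A \<le> tail_const / 16" using tail_const_pos by (simp add: A_def)
        then have "A * (real s - 1) \<le> tail_const / 16 * s"
          using A s by (intro mult_mono) auto
        then have "A * (real s - 1) * (c * L / sqrt \<sigma>) \<le> tail_const / 16 * s * (c * L / sqrt \<sigma>)"
          using c0 L0 \<sigma> by (intro mult_right_mono) auto
        then show ?thesis by (simp add: mult.commute mult.left_commute)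
      qed
      ultimately show ?thesis using ln2 by linarith
    next
      case False
      have "2 * real s \<le> real k"
      proof -
        have "s * 2 \<le> s * m" using m2 by (rule mult_le_mono2)
        then show ?thesis using smk by linarith
      qed
      then have "2 * (real s - 1) \<le> real k" by (simp add: right_diff_distrib)
      then have "2 * (real s - 1) * c\<^sup>2 \<le> real k * c\<^sup>2" by (rule mult_right_mono) simp
      then have "2 * ((real s - 1) * c\<^sup>2) \<le> real k * c\<^sup>2" by (simp only: mult.assoc)
      \<comment> \<open>In fact \<open>\<sigma>\<close> exceeds 1/2; the bound 1/4 is taken for its
        rational square root.\<close>
      then have "1 / 4 \<le> \<sigma>" using ck1 by (simp add: \<sigma>_def)
      then have "sqrt (1 / 4) \<le> sqrt \<sigma>" by (simp only: real_sqrt_le_iff)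
      then have \<sigma>2: "1 / 2 \<le> sqrt \<sigma>" by (simp add: real_sqrt_divide)
      \<comment> \<open>The logarithm is bounded crudely: c^2 * ln m <= c^2 * m <= c^2 * k <
        1.\<close>
      have cL: "c * L \<le> 1"
      proof (rule power2_le_imp_le)
        have "real m \<le> real k" using m1 by (simp add: m_def)
        moreover have "ln (real m) \<le> real m" using ln_le_minus_one[of "real m"] m1 by simp
        ultimately have "(c * L)\<^sup>2 \<le> c\<^sup>2 * real k"
          using m1 by (simp add: L_def power_mult_distrib mult_left_mono)
        then show "(c * L)\<^sup>2 \<le> 1\<^sup>2" using ck1 by (simp add: mult.commute)
      qed simp
      have "(c * (real s - 1) / sqrt \<sigma>) * L = (c * L) * ((real s - 1) / sqrt \<sigma>)" by simp
      also have "\<dots> \<le> 1 * (real s / (1 / 2))"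
        using cL s \<sigma> \<sigma>2 by (intro mult_mono frac_le divide_nonneg_nonneg) auto
      also have "\<dots> \<le> 2 * (8192 / tail_const\<^sup>2)" using False by simp
      finally have "A * ((c * (real s - 1) / sqrt \<sigma>) * L) \<le> A * (2 * (8192 / tail_const\<^sup>2))"
        using A by (intro mult_left_mono) auto
      also have "\<dots> = 1" using tail_const_pos by (simp add: A_def)
      finally have "A * (c * (real s - 1) / sqrt \<sigma>) * L \<le> 1" by (simp only: mult.assoc)
      then show ?thesis using K0 ln2 by linarith
    qed
  qed
  then show "tail_const\<^sup>2 / 16384 * (c * (real s - 1) / sqrt (1 - (real s - 1) * c\<^sup>2))
      * sqrt (ln (of_int \<lfloor>real k / real s\<rfloor>)) - sqrt (2 * ln 2) \<le> posi_K X (models p s) \<alpha>"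
    unfolding m_floor A_def \<sigma>_def L_def .
qed

end
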